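(* Let $\alpha,\beta\ge0$, $A\ge 0$, $B>0$, and for each $N$ let $X^N$ be the $(\alpha,\beta,A,B)$-boundary random walk started from $X^N_0=0$. Then there is a constant $C>0$, not depending on $N$, such that for all $N$ $$\mathbb{E}\big[\mathfrak{L}^{X^N}_N(0)\big]\le C\,N^{1/2+\beta}.$$
   Context: For each $N\in\mathbb{N}$ with $A/N^\alpha+B/N^\beta\le1$, $X^N=(X^N_n)_{n\ge0}$ is the discrete-time Markov chain on $\{\Delta\}\cup\{0,1,2,\dots\}$ which from $x\ge1$ jumps to $x+1$ and $x-1$ with probability $1/2$ each; from $0$ jumps to $1$ with probability $B/N^\beta$, to $\Delta$ with probability $A/N^\alpha$, and stays at $0$ otherwise; and $\Delta$ is absorbing. "For all $N$" means for all such $N$. The local time at the origin after $N$ steps is $\mathfrak{L}^{X^N}_N(0)=\sum_{k=0}^{N}\mathbf{1}_{[X^N_k=0]}$. *)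

theory Defs
  imports "HOL-Probability.Probability"
begin

text \<open>The state space is \<open>nat option\<close>, with \<open>None\<close> playing the role of the cemetery \<open>\<Delta>\<close>.\<close>

definition kill_prob :: "real \<Rightarrow> real \<Rightarrow> nat \<Rightarrow> real" where
  "kill_prob \<alpha> A N = A / real N powr \<alpha>"

definition exit_prob :: "real \<Rightarrow> real \<Rightarrow> nat \<Rightarrow> real" where
  "exit_prob \<beta> B N = B / real N powr \<beta>"

text \<open>\<open>N = 0\<close> has to be excluded by hand, because division by zero and \<open>0 powr 0\<close>
  are both \<open>0\<close> in HOL.\<close>

definition admissible :: "real \<Rightarrow> real \<Rightarrow> real \<Rightarrow> real \<Rightarrow> nat \<Rightarrow> bool" where
  "admissible \<alpha> \<beta> A B N \<longleftrightarrow> N \<ge> 1 \<and> kill_prob \<alpha> A N + exit_prob \<beta> B N \<le> 1"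

fun brw_trans ::
  "real \<Rightarrow> real \<Rightarrow> real \<Rightarrow> real \<Rightarrow> nat \<Rightarrow> nat option \<Rightarrow> nat option \<Rightarrow> real" where
  "brw_trans \<alpha> \<beta> A B N None y = (if y = None then 1 else 0)"
| "brw_trans \<alpha> \<beta> A B N (Some 0) y =
     (if y = Some 1 then exit_prob \<beta> B N
      else if y = None then kill_prob \<alpha> A N
      else if y = Some 0 then 1 - kill_prob \<alpha> A N - exit_prob \<beta> B N
      else 0)"
| "brw_trans \<alpha> \<beta> A B N (Some (Suc x)) y =
     (if y = Some (Suc x + 1) \<or> y = Some (Suc x - 1) then 1 / 2 else 0)"

definition markov_chain ::
  "'a measure \<Rightarrow> ('s \<Rightarrow> 's \<Rightarrow> real) \<Rightarrow> (nat \<Rightarrow> 'a \<Rightarrow> 's) \<Rightarrow> bool" where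
  "markov_chain M p X \<longleftrightarrow>
     prob_space M \<and>
     (\<forall>n. X n \<in> measurable M (count_space UNIV)) \<and>
     (\<forall>n x y. \<P>(\<omega> in M. \<forall>k\<le>n. X k \<omega> = x k) > 0 \<longrightarrow>
        \<P>(\<omega> in M. X (Suc n) \<omega> = y \<bar> \<forall>k\<le>n. X k \<omega> = x k) = p (x n) y)"

definition boundary_random_walk ::
  "real \<Rightarrow> real \<Rightarrow> real \<Rightarrow> real \<Rightarrow> nat \<Rightarrow> 'a measure \<Rightarrow> (nat \<Rightarrow> 'a \<Rightarrow> nat option) \<Rightarrow> bool" where
  "boundary_random_walk \<alpha> \<beta> A B N M X \<longleftrightarrow> markov_chain M (brw_trans \<alpha> \<beta> A B N) X"

definition local_time :: "(nat \<Rightarrow> 'a \<Rightarrow> 's) \<Rightarrow> nat \<Rightarrow> 's \<Rightarrow> 'a \<Rightarrow> real" where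
  "local_time X n x \<omega> = (\<Sum>k=0..n. indicator {x} (X k \<omega>))"

end

theory Submission
  imports Defs
begin

text \<open>Let \<open>h x = x\<close> and \<open>h \<Delta> = 0\<close>. Away from \<open>0\<close> the process \<open>h(X)\<close> is a martingale, and at \<open>0\<close>
  it has drift \<open>B / N\<^sup>\<beta>\<close>, so \<open>B / N\<^sup>\<beta>\<close> times the expected local time is \<open>E h(X\<^bsub>N+1\<^esub>)\<close>. Since
  \<open>h\<^sup>2(X)\<close> increases by at most \<open>1\<close> per step in the mean, \<open>E h(X\<^bsub>N+1\<^esub>) \<le> sqrt (N + 1)\<close>.\<close>

section \<open>One-step evolution of a Markov chain on a countable state space\<close>

text \<open>\<open>markov_chain\<close> speaks only of histories of positive probability. The
  product form extends to null histories: the event on the left lies inside the history, so both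
  sides vanish.\<close>

lemma markov_chain_history_step:
  fixes X :: "nat \<Rightarrow> 'a \<Rightarrow> 's::countable"
  assumes "markov_chain M p X"
  shows "emeasure M {\<omega>\<in>space M. X (Suc n) \<omega> = y \<and> (\<forall>k\<le>n. X k \<omega> = x k)} =
         ennreal (p (x n) y) * emeasure M {\<omega>\<in>space M. \<forall>k\<le>n. X k \<omega> = x k}"
proof -
  interpret prob_space M using assms by (simp add: markov_chain_def)
  have [measurable]: "X k \<in> measurable M (count_space UNIV)" for k
    using assms by (simp add: markov_chain_def)
  let ?H = "{\<omega>\<in>space M. \<forall>k\<le>n. X k \<omega> = x k}"
  let ?G = "{\<omega>\<in>space M. X (Suc n) \<omega> = y \<and> (\<forall>k\<le>n. X k \<omega> = x k)}"
  have [measurable]: "?H \<in> sets M" "?G \<in> sets M" by measurable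
  show ?thesis
  proof (cases "prob ?H > 0")
    case True
    then have p: "p (x n) y = prob ?G / prob ?H"
      using assms by (simp add: markov_chain_def cond_prob_def)
    then have "prob ?G = p (x n) y * prob ?H"
      using True by simp
    \<comment> \<open>\<open>ennreal\<close> truncates negative numbers to 0, so the sign of
      \<open>p\<close> matters; it comes from \<open>p\<close> being a quotient of probabilities
      here.\<close>
    moreover have "p (x n) y \<ge> 0"
      unfolding p by (intro divide_nonneg_nonneg measure_nonneg)
    ultimately show ?thesis
      by (simp add: emeasure_eq_measure ennreal_mult)
  next
    case False
    then have "prob ?H = 0" by (simp add: not_less measure_le_0_iff)
    moreover have "prob ?G \<le> prob ?H" by (intro finite_measure_mono) auto
    ultimately show ?thesis by (simp add: emeasure_eq_measure measure_le_0_iff)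
  qed
qed

text \<open>Summing over all histories that end in \<open>x\<close> replaces conditioning on the
  whole past by conditioning on the present, because the transition factor depends on the history
  only through its last state.\<close>

lemma markov_chain_joint_step:
  fixes X :: "nat \<Rightarrow> 'a \<Rightarrow> 's::countable"
  assumes "markov_chain M p X"
  shows "emeasure M {\<omega>\<in>space M. X n \<omega> = x \<and> X (Suc n) \<omega> = y} =
         ennreal (p x y) * emeasure M {\<omega>\<in>space M. X n \<omega> = x}"
proof -
  have [measurable]: "X k \<in> measurable M (count_space UNIV)" for k
    using assms by (simp add: markov_chain_def)
  \<comment> \<open>Histories are encoded as lists because lists over a countable type form a
    countable type, which countable additivity requires.\<close>
  define L where "L = {l::'s list. length l = Suc n \<and> l ! n = x}"
  define H where "H l = {\<omega>\<in>space M. \<forall>k\<le>n. X k \<omega> = l ! k}" for l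
  define G where "G l = {\<omega>\<in>space M. X (Suc n) \<omega> = y \<and> (\<forall>k\<le>n. X k \<omega> = l ! k)}" for l
  have sets: "H l \<in> sets M" "G l \<in> sets M" for l
    unfolding H_def G_def by measurable
  have eq: "l = l'" if "l \<in> L" "l' \<in> L" "\<forall>k\<le>n. X k \<omega> = l ! k" "\<forall>k\<le>n. X k \<omega> = l' ! k" for l l' \<omega>
    using that unfolding L_def by (auto intro!: nth_equalityI simp: less_Suc_eq_le)
  have disj: "disjoint_family_on H L" "disjoint_family_on G L"
    unfolding disjoint_family_on_def H_def G_def using eq by auto
  have path: "\<exists>l\<in>L. \<forall>k\<le>n. X k \<omega> = l ! k" if "X n \<omega> = x" for \<omega>
    using that unfolding L_def
    by (intro bexI[of _ "map (\<lambda>k. X k \<omega>) [0..<Suc n]"]) (auto simp del: upt_Suc)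
  have H: "{\<omega>\<in>space M. X n \<omega> = x} = (\<Union>l\<in>L. H l)"
    using path unfolding H_def L_def by fastforce
  have G: "{\<omega>\<in>space M. X n \<omega> = x \<and> X (Suc n) \<omega> = y} = (\<Union>l\<in>L. G l)"
    using path unfolding G_def L_def by fastforce
  have "emeasure M (\<Union>l\<in>L. G l) = (\<integral>\<^sup>+l. emeasure M (G l) \<partial>count_space L)"
    using sets disj by (intro emeasure_UN_countable) auto
  also have "\<dots> = (\<integral>\<^sup>+l. ennreal (p x y) * emeasure M (H l) \<partial>count_space L)"
    using markov_chain_history_step[OF assms]
    by (intro nn_integral_cong) (auto simp: G_def H_def L_def)
  also have "\<dots> = ennreal (p x y) * (\<integral>\<^sup>+l. emeasure M (H l) \<partial>count_space L)"
    by (simp add: nn_integral_cmult)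
  also have "(\<integral>\<^sup>+l. emeasure M (H l) \<partial>count_space L) = emeasure M (\<Union>l\<in>L. H l)"
    using sets disj by (intro emeasure_UN_countable[symmetric]) auto
  finally show ?thesis by (simp add: G H)
qed

text \<open>Split \<open>g (Y \<omega>)\<close> according to the value of \<open>Y\<close> and
  exchange sum and integral by Tonelli. With values in \<open>ennreal\<close>, unbounded
  \<open>g\<close> raises no integrability question.\<close>

lemma nn_integral_countable_valued:
  fixes Y :: "'a \<Rightarrow> 's::countable" and g :: "'s \<Rightarrow> ennreal"
  assumes [measurable]: "Y \<in> measurable M (count_space UNIV)"
  shows "(\<integral>\<^sup>+\<omega>. g (Y \<omega>) \<partial>M) =
         (\<integral>\<^sup>+x. g x * emeasure M {\<omega>\<in>space M. Y \<omega> = x} \<partial>count_space UNIV)"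
proof -
  have "(\<integral>\<^sup>+\<omega>. g (Y \<omega>) \<partial>M) = (\<integral>\<^sup>+\<omega>. \<integral>\<^sup>+x. g x * indicator {\<omega>\<in>space M. Y \<omega> = x} \<omega> \<partial>count_space UNIV \<partial>M)"
  proof (intro nn_integral_cong)
    fix \<omega> assume "\<omega> \<in> space M"
    then show "g (Y \<omega>) = (\<integral>\<^sup>+x. g x * indicator {\<omega>\<in>space M. Y \<omega> = x} \<omega> \<partial>count_space UNIV)"
      by (subst nn_integral_count_space'[of "{Y \<omega>}"]) (auto simp: indicator_def)
  qed
  also have "\<dots> = (\<integral>\<^sup>+x. \<integral>\<^sup>+\<omega>. g x * indicator {\<omega>\<in>space M. Y \<omega> = x} \<omega> \<partial>M \<partial>count_space UNIV)"
    by (subst nn_integral_count_space_nn_integral) auto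
  also have "\<dots> = (\<integral>\<^sup>+x. g x * emeasure M {\<omega>\<in>space M. Y \<omega> = x} \<partial>count_space UNIV)"
    by (simp add: nn_integral_cmult_indicator)
  finally show ?thesis .
qed

text \<open>The pair \<open>(X n, X (Suc n))\<close> is treated as one countable-valued variable;
  its law factorises by \<open>markov_chain_joint_step\<close>, and the inner sum over
  \<open>y\<close> is the transition operator applied to \<open>f\<close>.\<close>

lemma nn_integral_markov_chain_Suc:
  fixes X :: "nat \<Rightarrow> 'a \<Rightarrow> 's::countable" and f :: "'s \<Rightarrow> ennreal"
  assumes "markov_chain M p X"
  shows "(\<integral>\<^sup>+\<omega>. f (X (Suc n) \<omega>) \<partial>M) =
         (\<integral>\<^sup>+\<omega>. (\<integral>\<^sup>+y. f y * ennreal (p (X n \<omega>) y) \<partial>count_space UNIV) \<partial>M)"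
proof -
  have [measurable]: "X k \<in> measurable M (count_space UNIV)" for k
    using assms by (simp add: markov_chain_def)
  have "(\<integral>\<^sup>+\<omega>. f (X (Suc n) \<omega>) \<partial>M) =
        (\<integral>\<^sup>+z. f (snd z) * emeasure M {\<omega>\<in>space M. (X n \<omega>, X (Suc n) \<omega>) = z} \<partial>count_space UNIV)"
    by (subst nn_integral_countable_valued[symmetric]) auto
  also have "\<dots> = (\<integral>\<^sup>+z. f (snd z) * (ennreal (p (fst z) (snd z)) *
      emeasure M {\<omega>\<in>space M. X n \<omega> = fst z}) \<partial>count_space UNIV)"
    by (simp add: markov_chain_joint_step[OF assms, symmetric] prod_eq_iff)
  also have "\<dots> = (\<integral>\<^sup>+x. \<integral>\<^sup>+y. f y * (ennreal (p x y) *
      emeasure M {\<omega>\<in>space M. X n \<omega> = x}) \<partial>count_space UNIV \<partial>count_space UNIV)"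
    by (subst nn_integral_fst_count_space[symmetric]) simp
  also have "\<dots> = (\<integral>\<^sup>+x. (\<integral>\<^sup>+y. f y * ennreal (p x y) \<partial>count_space UNIV) *
      emeasure M {\<omega>\<in>space M. X n \<omega> = x} \<partial>count_space UNIV)"
    by (simp add: nn_integral_multc mult.assoc[symmetric])
  also have "\<dots> = (\<integral>\<^sup>+\<omega>. (\<integral>\<^sup>+y. f y * ennreal (p (X n \<omega>) y) \<partial>count_space UNIV) \<partial>M)"
    by (subst nn_integral_countable_valued[symmetric]) auto
  finally show ?thesis .
qed

section \<open>Drift of the height and of its square under one transition\<close>

text \<open>The cemetery gets the same value as the origin, so being killed does not change the
  height and the killing rate drops out of the drift.\<close>

fun height :: "nat option \<Rightarrow> real" where
  "height None = 0"
| "height (Some n) = real n"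

lemma height_nonneg [simp]: "0 \<le> height x"
  by (cases x) auto

text \<open>Only the jump to \<open>Some 1\<close> survives. Stated for general \<open>f\<close> to
  serve both the height and its square.\<close>

lemma nn_integral_brw_trans_0:
  assumes "f None = 0" "f (Some 0) = 0"
  shows "(\<integral>\<^sup>+y. ennreal (f y) * ennreal (brw_trans \<alpha> \<beta> A B N (Some 0) y) \<partial>count_space UNIV) =
         ennreal (f (Some 1)) * ennreal (exit_prob \<beta> B N)"
  using assms by (subst nn_integral_count_space'[of "{Some 1}"]) auto

lemma nn_integral_brw_trans_Suc:
  assumes "\<And>y. f y \<ge> 0"
  shows "(\<integral>\<^sup>+y. ennreal (f y) * ennreal (brw_trans \<alpha> \<beta> A B N (Some (Suc m)) y) \<partial>count_space UNIV) =
         ennreal ((f (Some (Suc (Suc m))) + f (Some m)) / 2)"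
  using assms by (subst nn_integral_count_space'[of "{Some (Suc (Suc m)), Some m}"])
    (auto simp: divide_ennreal[symmetric] divide_ennreal_def distrib_right)

lemma nn_integral_brw_trans_height:
  assumes "exit_prob \<beta> B N \<ge> 0"
  shows "(\<integral>\<^sup>+y. ennreal (height y) * ennreal (brw_trans \<alpha> \<beta> A B N x y) \<partial>count_space UNIV) =
         ennreal (height x) + ennreal (exit_prob \<beta> B N) * indicator {Some 0} x"
\<comment> \<open>The split is on \<open>x\<close> alone: cemetery, origin, interior. The final
  \<open>None\<close> is a dummy target state that completes the argument tuple of
  \<open>brw_trans\<close>.\<close>
proof (cases "(\<alpha>, \<beta>, A, B, N, x, None :: nat option)" rule: brw_trans.cases)
  case 1
  then show ?thesis by (subst nn_integral_count_space'[of "{None}"]) auto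
next
  case 2
  then show ?thesis using nn_integral_brw_trans_0[of height] by auto
next
  case 3
  then show ?thesis using nn_integral_brw_trans_Suc[of height] by (auto simp: add_divide_distrib)
qed

text \<open>In the interior the gain is exactly 1, the variance of a fair step of size 1. At the
  origin it is the exit probability, at most 1, and at the cemetery it is 0.\<close>

lemma nn_integral_brw_trans_height_sq_le:
  assumes "0 \<le> exit_prob \<beta> B N" "exit_prob \<beta> B N \<le> 1"
  shows "(\<integral>\<^sup>+y. ennreal ((height y)\<^sup>2) * ennreal (brw_trans \<alpha> \<beta> A B N x y) \<partial>count_space UNIV) \<le>
         ennreal ((height x)\<^sup>2) + 1"
proof (cases "(\<alpha>, \<beta>, A, B, N, x, None :: nat option)" rule: brw_trans.cases)
  case 1
  then show ?thesis by (subst nn_integral_count_space'[of "{None}"]) auto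
next
  case 2
  then show ?thesis using nn_integral_brw_trans_0[of "\<lambda>y. (height y)\<^sup>2"] assms by auto
next
  case (3 _ _ _ _ _ m)
  have "ennreal (((real (Suc (Suc m)))\<^sup>2 + (real m)\<^sup>2) / 2) = ennreal ((real (Suc m))\<^sup>2 + 1)"
    by (intro arg_cong[where f = ennreal]) (simp add: power2_eq_square field_simps)
  also have "\<dots> = ennreal ((real (Suc m))\<^sup>2) + 1"
    by simp
  finally have "ennreal (((real (Suc (Suc m)))\<^sup>2 + (real m)\<^sup>2) / 2) = ennreal ((real (Suc m))\<^sup>2) + 1" .
  then show ?thesis
    using 3 nn_integral_brw_trans_Suc[of "\<lambda>y. (height y)\<^sup>2"]
    by (simp del: of_nat_Suc)
qed

section \<open>Moments of the height and the expected local time\<close>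

context
  fixes \<alpha> \<beta> A B :: real and N :: nat and M :: "'a measure" and X :: "nat \<Rightarrow> 'a \<Rightarrow> nat option"
  assumes walk: "boundary_random_walk \<alpha> \<beta> A B N M X"
    and start: "AE \<omega> in M. X 0 \<omega> = Some 0"
    and exit: "0 \<le> exit_prob \<beta> B N"
begin

interpretation prob_space M
  using walk by (simp add: boundary_random_walk_def markov_chain_def)

lemma measurable_walk [measurable]: "X k \<in> measurable M (count_space UNIV)"
  using walk by (simp add: boundary_random_walk_def markov_chain_def)

lemmas nn_integral_Suc = nn_integral_markov_chain_Suc[OF walk[unfolded boundary_random_walk_def]]

text \<open>The drift identity telescopes from height 0 at time 0. The sum stops before
  \<open>n\<close>, since the height at time \<open>n\<close> reflects only the visits made
  earlier.\<close>

lemma nn_integral_height: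
  "(\<integral>\<^sup>+\<omega>. ennreal (height (X n \<omega>)) \<partial>M) =
   ennreal (exit_prob \<beta> B N * (\<Sum>k<n. prob {\<omega>\<in>space M. X k \<omega> = Some 0}))"
proof (induction n)
  case 0
  have "(\<integral>\<^sup>+\<omega>. ennreal (height (X 0 \<omega>)) \<partial>M) = (\<integral>\<^sup>+\<omega>. 0 \<partial>M)"
    using start by (intro nn_integral_cong_AE) auto
  then show ?case by simp
next
  case (Suc n)
  have ind: "(\<integral>\<^sup>+\<omega>. indicator {Some 0} (X n \<omega>) \<partial>M) = ennreal (prob {\<omega>\<in>space M. X n \<omega> = Some 0})"
  proof -
    have "(\<integral>\<^sup>+\<omega>. indicator {Some 0} (X n \<omega>) \<partial>M) = (\<integral>\<^sup>+\<omega>. indicator {\<omega>\<in>space M. X n \<omega> = Some 0} \<omega> \<partial>M)"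
      by (intro nn_integral_cong) (auto simp: indicator_def)
    then show ?thesis by (simp add: emeasure_eq_measure)
  qed
  have "(\<integral>\<^sup>+\<omega>. ennreal (height (X (Suc n) \<omega>)) \<partial>M) =
        (\<integral>\<^sup>+\<omega>. ennreal (height (X n \<omega>)) + ennreal (exit_prob \<beta> B N) * indicator {Some 0} (X n \<omega>) \<partial>M)"
    by (subst nn_integral_Suc) (simp only: nn_integral_brw_trans_height[OF exit])
  also have "\<dots> = (\<integral>\<^sup>+\<omega>. ennreal (height (X n \<omega>)) \<partial>M) +
      ennreal (exit_prob \<beta> B N) * ennreal (prob {\<omega>\<in>space M. X n \<omega> = Some 0})"
    by (subst nn_integral_add) (auto simp: nn_integral_cmult ind)
  finally show ?case
    using exit by (simp add: Suc.IH ennreal_mult[symmetric] ennreal_plus[symmetric] sum_nonneg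
        distrib_left del: ennreal_plus)
qed

lemma nn_integral_height_sq_le:
  assumes "exit_prob \<beta> B N \<le> 1"
  shows "(\<integral>\<^sup>+\<omega>. ennreal ((height (X n \<omega>))\<^sup>2) \<partial>M) \<le> of_nat n"
proof (induction n)
  case 0
  have "(\<integral>\<^sup>+\<omega>. ennreal ((height (X 0 \<omega>))\<^sup>2) \<partial>M) = (\<integral>\<^sup>+\<omega>. 0 \<partial>M)"
    using start by (intro nn_integral_cong_AE) auto
  then show ?case by simp
next
  case (Suc n)
  have "(\<integral>\<^sup>+\<omega>. ennreal ((height (X (Suc n) \<omega>))\<^sup>2) \<partial>M) \<le> (\<integral>\<^sup>+\<omega>. ennreal ((height (X n \<omega>))\<^sup>2) + 1 \<partial>M)"
    by (subst nn_integral_Suc) (intro nn_integral_mono nn_integral_brw_trans_height_sq_le exit assms)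
  also have "\<dots> = (\<integral>\<^sup>+\<omega>. ennreal ((height (X n \<omega>))\<^sup>2) \<partial>M) + 1"
    by (subst nn_integral_add) (auto simp: emeasure_space_1)
  also have "\<dots> \<le> of_nat n + 1"
    using Suc.IH by (rule add_right_mono)
  finally show ?case by (simp add: add.commute)
qed

text \<open>A first moment is bounded by a second moment. In place of Cauchy-Schwarz, a pointwise
  quadratic bound is integrated, which stays within nonnegative integrals. The case
  \<open>n = 0\<close> is separate because \<open>s\<close> is a denominator.\<close>

lemma nn_integral_height_le:
  assumes "exit_prob \<beta> B N \<le> 1"
  shows "(\<integral>\<^sup>+\<omega>. ennreal (height (X n \<omega>)) \<partial>M) \<le> ennreal (sqrt n)"
proof (cases "n = 0")
  case True
  then show ?thesis using nn_integral_height[of 0] by simp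
next
  case False
  \<comment> \<open>This \<open>s\<close> balances the two terms: once the second moment is bounded
    by \<open>n\<close>, both \<open>n / (2 * s)\<close> and \<open>s / 2\<close> equal half of
    \<open>sqrt n\<close>.\<close>
  define s where "s = sqrt n"
  have s: "s > 0" "s\<^sup>2 = n" using False by (auto simp: s_def)
  have "t \<le> t\<^sup>2 / (2 * s) + s / 2" for t :: real
  proof -
    have "t\<^sup>2 / (2 * s) + s / 2 - t = (t - s)\<^sup>2 / (2 * s)"
      using s by (simp add: field_simps power2_eq_square)
    moreover have "(t - s)\<^sup>2 / (2 * s) \<ge> 0" using s by simp
    ultimately show ?thesis by linarith
  qed
  then have "(\<integral>\<^sup>+\<omega>. ennreal (height (X n \<omega>)) \<partial>M) \<le>
      (\<integral>\<^sup>+\<omega>. ennreal (1 / (2 * s)) * ennreal ((height (X n \<omega>))\<^sup>2) + ennreal (s / 2) \<partial>M)"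
    using s by (intro nn_integral_mono)
      (auto simp: ennreal_mult[symmetric] ennreal_plus[symmetric] simp del: ennreal_plus intro!: ennreal_leI)
  also have "\<dots> = ennreal (1 / (2 * s)) * (\<integral>\<^sup>+\<omega>. ennreal ((height (X n \<omega>))\<^sup>2) \<partial>M) + ennreal (s / 2)"
    by (subst nn_integral_add) (auto simp: nn_integral_cmult emeasure_space_1)
  also have "\<dots> \<le> ennreal (1 / (2 * s)) * of_nat n + ennreal (s / 2)"
    by (intro add_right_mono mult_left_mono nn_integral_height_sq_le assms) auto
  also have "\<dots> = ennreal (s\<^sup>2 / (2 * s) + s / 2)"
    using s by (simp add: ennreal_of_nat_eq_real_of_nat ennreal_mult[symmetric] ennreal_plus[symmetric]
        del: ennreal_plus)
  also have "s\<^sup>2 / (2 * s) + s / 2 = s"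
    using s(1) by (simp add: power2_eq_square)
  finally show ?thesis by (simp add: s_def)
qed

lemma expectation_local_time:
  "expectation (local_time X n (Some 0)) = (\<Sum>k<Suc n. prob {\<omega>\<in>space M. X k \<omega> = Some 0})"
proof -
  have "expectation (local_time X n (Some 0)) =
      expectation (\<lambda>\<omega>. \<Sum>k<Suc n. indicator {\<omega>\<in>space M. X k \<omega> = Some 0} \<omega>)"
    by (intro Bochner_Integration.integral_cong)
      (auto simp: local_time_def indicator_def atLeast0AtMost lessThan_Suc_atMost intro!: sum.cong)
  also have "\<dots> = (\<Sum>k<Suc n. prob {\<omega>\<in>space M. X k \<omega> = Some 0})"
    by (subst Bochner_Integration.integral_sum) (auto simp: less_top[symmetric])
  finally show ?thesis .
qed

text \<open>The local time includes the visit at time \<open>n\<close> itself, so the height is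
  taken at time \<open>Suc n\<close>.\<close>

lemma exit_prob_expectation_local_time_le:
  assumes "exit_prob \<beta> B N \<le> 1"
  shows "exit_prob \<beta> B N * expectation (local_time X n (Some 0)) \<le> sqrt (Suc n)"
  using nn_integral_height_le[OF assms, of "Suc n"]
  unfolding expectation_local_time nn_integral_height by simp

end

theorem corollary3p2:
  fixes \<alpha> \<beta> A B :: real
    and M :: "nat \<Rightarrow> 'a measure"
    and X :: "nat \<Rightarrow> nat \<Rightarrow> 'a \<Rightarrow> nat option"
  assumes "\<alpha> \<ge> 0" and "\<beta> \<ge> 0" and "A \<ge> 0" and "B > 0"
    and "\<And>N. admissible \<alpha> \<beta> A B N \<Longrightarrow> boundary_random_walk \<alpha> \<beta> A B N (M N) (X N)"
    and "\<And>N. admissible \<alpha> \<beta> A B N \<Longrightarrow> AE \<omega> in M N. X N 0 \<omega> = Some 0"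
  shows "\<exists>C>0. \<forall>N. admissible \<alpha> \<beta> A B N \<longrightarrow>
           prob_space.expectation (M N) (local_time (X N) N (Some 0)) \<le> C * real N powr (1 / 2 + \<beta>)"
\<comment> \<open>The factor \<open>sqrt 2\<close> absorbs the extra time step, as N + 1 is at most
  2N for positive N; \<open>1 / B\<close> comes from dividing by the exit probability.\<close>
proof (intro exI[of _ "sqrt 2 / B"] conjI allI impI)
  show "0 < sqrt 2 / B" using \<open>B > 0\<close> by simp
next
  fix N assume adm: "admissible \<alpha> \<beta> A B N"
  let ?E = "prob_space.expectation (M N) (local_time (X N) N (Some 0))"
  have N: "N \<ge> 1" and le1: "kill_prob \<alpha> A N + exit_prob \<beta> B N \<le> 1"
    using adm by (auto simp: admissible_def)
  have "kill_prob \<alpha> A N \<ge> 0" "exit_prob \<beta> B N \<ge> 0"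
    using \<open>A \<ge> 0\<close> \<open>B > 0\<close> by (auto simp: kill_prob_def exit_prob_def)
  \<comment> \<open>Admissibility bounds the sum of the two probabilities; since the killing
    probability is nonnegative, the exit probability is at most 1.\<close>
  then have "exit_prob \<beta> B N * ?E \<le> sqrt (Suc N)"
    using le1 by (intro exit_prob_expectation_local_time_le[OF assms(5,6)] adm) auto
  also have "\<dots> \<le> sqrt (2 * real N)"
    using N by (intro real_sqrt_le_mono) auto
  also have "\<dots> = sqrt 2 * real N powr (1 / 2)"
    by (simp add: real_sqrt_mult powr_half_sqrt)
  \<comment> \<open>Dividing by \<open>B / real N powr \<beta>\<close> supplies the remaining power
    of N.\<close>
  finally show "?E \<le> sqrt 2 / B * real N powr (1 / 2 + \<beta>)"
    using N \<open>B > 0\<close> unfolding powr_add by (simp add: exit_prob_def field_simps)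
qed

end
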